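(* Let $G_1,\dots,G_k$ be finite simple connected graphs, each on at least two vertices, such that for at least two indices $i\in\{1,\dots,k\}$ the girth of $E(G_i)$ is greater than two (i.e. $E(G_i)$ contains a cycle). Let $G=G_1\square\cdots\square G_k$ be their Cartesian product. Then the girth of $E(G)$ is four, except when the girth of $E(G_i)$ is exactly three for all $i\in\{1,\dots,k\}$.
   Context: For a connected simple graph $G$, $d_G$ is the graph distance and $e_G(v)=\max\{d_G(u,v):u\in V(G)\}$. A vertex $u$ is eccentric to $v$ if $d_G(u,v)=e_G(v)$. The eccentric graph $E(G)$ is the simple graph on vertex set $V(G)$ in which two distinct vertices $u,v$ are adjacent iff $u$ is eccentric to $v$ or $v$ is eccentric to $u$. The girth of a graph is the length of its shortest cycle, with the convention that a graph with no cycles has girth $0$. In the Cartesian product $G_1\square\cdots\square G_k$, the vertices are the $k$-tuples in $V(G_1)\times\cdots\times V(G_k)$, and two tuples are adjacent iff they differ in exactly one coordinate $i$ and their $i$-th coordinates are adjacent in $G_i$. *)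

theory Defs
  imports "Graph_Theory.Graph_Theory"
begin

text \<open>
  Finite simple graphs are the symmetric, loop-free, finite digraphs without parallel arcs
  of locale \<^locale>\<open>pair_graph\<close>; an undirected edge is a pair of opposite arcs.
\<close>

definition gdist :: "'a pair_pre_digraph \<Rightarrow> 'a \<Rightarrow> 'a \<Rightarrow> nat" where
  "gdist G u v = (LEAST n. \<exists>p. pre_digraph.awalk (with_proj G) u p v \<and> length p = n)"

definition ecc :: "'a pair_pre_digraph \<Rightarrow> 'a \<Rightarrow> nat" where
  "ecc G v = Max {gdist G u v | u. u \<in> pverts G}"

definition eccentric_to :: "'a pair_pre_digraph \<Rightarrow> 'a \<Rightarrow> 'a \<Rightarrow> bool" where
  "eccentric_to G u v \<longleftrightarrow> u \<in> pverts G \<and> v \<in> pverts G \<and> gdist G u v = ecc G v"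

definition eccentric_graph :: "'a pair_pre_digraph \<Rightarrow> 'a pair_pre_digraph" where
  "eccentric_graph G = \<lparr> pverts = pverts G,
     parcs = {(u, v). u \<in> pverts G \<and> v \<in> pverts G \<and> u \<noteq> v \<and>
                      (eccentric_to G u v \<or> eccentric_to G v u)} \<rparr>"

text \<open>
  In a symmetric digraph, the library's \<^const>\<open>pre_digraph.cycle\<close> also admits the closed walk
  \<open>u, v, u\<close> along an edge and back; a cycle of a simple graph has at least three edges.
\<close>

definition graph_cycle :: "'a pair_pre_digraph \<Rightarrow> ('a \<times> 'a) awalk \<Rightarrow> bool" where
  "graph_cycle G p \<longleftrightarrow> pre_digraph.cycle (with_proj G) p \<and> 3 \<le> length p"

definition girth :: "'a pair_pre_digraph \<Rightarrow> nat" where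
  "girth G = (if \<exists>p. graph_cycle G p
              then (LEAST n. \<exists>p. graph_cycle G p \<and> length p = n) else 0)"

text \<open>
  Tuples are functions on the index set \<open>I\<close>, made extensional (\<^const>\<open>undefined\<close> outside \<open>I\<close>)
  so that they are determined by their coordinates.
\<close>

definition cartesian_product ::
    "'i set \<Rightarrow> ('i \<Rightarrow> 'a pair_pre_digraph) \<Rightarrow> ('i \<Rightarrow> 'a) pair_pre_digraph" where
  "cartesian_product I G = \<lparr> pverts = (\<Pi>\<^sub>E i\<in>I. pverts (G i)),
     parcs = {(x, y). x \<in> (\<Pi>\<^sub>E i\<in>I. pverts (G i)) \<and> y \<in> (\<Pi>\<^sub>E i\<in>I. pverts (G i)) \<and>
                      (\<exists>i\<in>I. {j \<in> I. x j \<noteq> y j} = {i} \<and> (x i, y i) \<in> parcs (G i))} \<rparr>"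

lemma girth_gt_2_iff: "2 < girth G \<longleftrightarrow> (\<exists>p. graph_cycle G p)"
proof
  assume *: "\<exists>p. graph_cycle G p"
  then have "\<exists>n p. graph_cycle G p \<and> length p = n" by blast
  from LeastI_ex[OF this] * obtain p where "graph_cycle G p" "length p = girth G"
    unfolding girth_def by auto
  then show "2 < girth G"
    unfolding graph_cycle_def by linarith
qed (auto simp: girth_def split: if_splits)

lemma pair_graph_eccentric_graph:
  assumes "finite (pverts G)"
  shows "pair_graph (eccentric_graph G)"
proof -
  have "finite (parcs (eccentric_graph G))"
    by (rule finite_subset[of _ "pverts G \<times> pverts G"])
       (auto simp: eccentric_graph_def assms)
  then show ?thesis
    by unfold_locales
       (auto simp: eccentric_graph_def symmetric_def assms intro: symI)
qed

lemma pair_graph_cartesian_product: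
  assumes "finite I" and "\<And>i. i \<in> I \<Longrightarrow> pair_graph (G i)"
  shows "pair_graph (cartesian_product I G)"
proof -
  let ?V = "\<Pi>\<^sub>E i\<in>I. pverts (G i)"
  have fin: "finite ?V"
  proof (rule finite_PiE[OF assms(1)])
    fix i assume "i \<in> I"
    then interpret pair_graph "G i" by (rule assms(2))
    show "finite (pverts (G i))" by (rule pair_finite_verts)
  qed
  have "finite (parcs (cartesian_product I G))"
    by (rule finite_subset[of _ "?V \<times> ?V"]) (auto simp: cartesian_product_def fin)
  moreover have "sym (parcs (cartesian_product I G))"
  proof (rule symI)
    fix x y assume "(x, y) \<in> parcs (cartesian_product I G)"
    then obtain i where *: "x \<in> ?V" "y \<in> ?V" "i \<in> I" "{j \<in> I. x j \<noteq> y j} = {i}"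
        "(x i, y i) \<in> parcs (G i)"
      by (auto simp: cartesian_product_def)
    interpret pair_graph "G i" using assms(2) * by blast
    have "(y i, x i) \<in> parcs (G i)"
      using *(5) by (rule arcs_symmetric)
    moreover have "{j \<in> I. y j \<noteq> x j} = {j \<in> I. x j \<noteq> y j}"
      by auto
    ultimately have "(y i, x i) \<in> parcs (G i)" "{j \<in> I. y j \<noteq> x j} = {i}"
      using *(4) by simp_all
    with * show "(y, x) \<in> parcs (cartesian_product I G)"
      by (auto simp: cartesian_product_def)
  qed
  ultimately show ?thesis
    by unfold_locales (auto simp: cartesian_product_def symmetric_def fin)
qed

end

theory Submission
  imports Defs
begin

text \<open>
  Distances in a Cartesian product add up, so \<open>x\<close> is eccentric to \<open>y\<close> in the product iff this
  holds in every coordinate. An edge of an eccentric graph always witnesses that the endpoint of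
  larger eccentricity is eccentric to the other one. Hence a cycle in \<open>E(G\<^sub>i)\<close> has a vertex (of
  minimal eccentricity on it) with two eccentric vertices, and a vertex (of maximal eccentricity)
  that is eccentric to two others; one configuration of each kind in two different coordinates
  combine to a 4-cycle of \<open>E(G)\<close>. Moreover, every triangle of an eccentric graph can
  be oriented transitively, so \<open>E(G)\<close> has a triangle iff every \<open>E(G\<^sub>i)\<close> has one.
\<close>

section \<open>Girth\<close>

context pair_graph
begin

text \<open>The vertices of a walk \<open>p\<close> from \<open>u\<close> are
  \<open>u # map snd p\<close>, so the distinctness in \<open>cycle\<close> concerns just the heads
  of the arcs; the length bound makes \<open>p\<close> nonempty and its arcs place \<open>u\<close>
  in the graph.\<close>

lemma graph_cycle_iff:
  "graph_cycle G p \<longleftrightarrow>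
    set p \<subseteq> parcs G \<and> (\<exists>u. pcas u p u) \<and> distinct (map snd p) \<and> 3 \<le> length p"
proof -
  have *: "pawalk_verts u p = u # map snd p" if "pcas u p v" for u v
    using that by (induct u p v rule: pcas.induct) auto
  have "u \<in> pverts G" if "pcas u p u" "set p \<subseteq> parcs G" "3 \<le> length p" for u
    using that by (cases p) (auto intro: in_arcsD1)
  then show ?thesis
    unfolding graph_cycle_def cycle_def awalk_def using * by fastforce
qed

lemma girth_eq_3_iff:
  "girth G = 3 \<longleftrightarrow> (\<exists>a b c. (a, b) \<in> parcs G \<and> (b, c) \<in> parcs G \<and> (c, a) \<in> parcs G)"
proof
  assume girth: "girth G = 3"
  then have ex: "\<exists>p. graph_cycle G p"
    using girth_gt_2_iff[of G] by simp
  then have "\<exists>n p. graph_cycle G p \<and> length p = n" by blast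
  from LeastI_ex[OF this] ex girth obtain p where p: "graph_cycle G p" "length p = 3"
    unfolding girth_def by auto
  then obtain a b c where "p = [(a, b), (b, c), (c, a)]"
    by (auto simp: graph_cycle_iff numeral_3_eq_3 length_Suc_conv)
  with p(1) show "\<exists>a b c. (a, b) \<in> parcs G \<and> (b, c) \<in> parcs G \<and> (c, a) \<in> parcs G"
    by (auto simp: graph_cycle_iff)
next
  assume "\<exists>a b c. (a, b) \<in> parcs G \<and> (b, c) \<in> parcs G \<and> (c, a) \<in> parcs G"
  then obtain a b c where abc: "(a, b) \<in> parcs G" "(b, c) \<in> parcs G" "(c, a) \<in> parcs G"
    by blast
  then have "a \<noteq> b" "b \<noteq> c" "c \<noteq> a"
    using no_loops' by blast+
  with abc have c: "graph_cycle G [(a, b), (b, c), (c, a)]"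
    by (auto simp: graph_cycle_iff)
  then have "girth G \<le> length [(a, b), (b, c), (c, a)]"
    unfolding girth_def by (auto intro!: Least_le)
  with c girth_gt_2_iff[of G] show "girth G = 3"
    by (auto simp: le_Suc_eq)
qed

text \<open>Adjacent corners differ because there are no loops, so only the two diagonals need
  explicit inequalities.\<close>

lemma girth_le_4:
  assumes "(a, b) \<in> parcs G" "(b, c) \<in> parcs G" "(c, d) \<in> parcs G" "(d, a) \<in> parcs G"
    and "a \<noteq> c" "b \<noteq> d"
  shows "girth G = 3 \<or> girth G = 4"
proof -
  have "a \<noteq> b" "b \<noteq> c" "c \<noteq> d" "d \<noteq> a"
    using assms no_loops' by blast+
  with assms have c: "graph_cycle G [(a, b), (b, c), (c, d), (d, a)]"
    by (auto simp: graph_cycle_iff)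
  then have "girth G \<le> length [(a, b), (b, c), (c, d), (d, a)]"
    unfolding girth_def by (auto intro!: Least_le)
  moreover have "girth G > 2"
    using c girth_gt_2_iff[of G] by blast
  ultimately show ?thesis by auto
qed

text \<open>\<open>S\<close> is the vertex set of a cycle. Keeping only this closure property lets
  later arguments pick a vertex of \<open>S\<close> extremal for eccentricity and compare it with
  two neighbours in \<open>S\<close>.\<close>

lemma two_neighbours_on_cycle:
  assumes "2 < girth G"
  obtains S where "finite S" "S \<noteq> {}"
    "\<And>v. v \<in> S \<Longrightarrow> \<exists>u\<in>S. \<exists>w\<in>S. u \<noteq> w \<and> (v, u) \<in> parcs G \<and> (v, w) \<in> parcs G"
proof -
  obtain p where "graph_cycle G p"
    using assms girth_gt_2_iff by blast
  then obtain u where arcs: "set p \<subseteq> parcs G" and cas: "pcas u p u"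
    and dist: "distinct (map snd p)" and len: "3 \<le> length p"
    by (auto simp: graph_cycle_iff)
  have start: "fst (p ! i) = (if i = 0 then u else snd (p ! (i - 1)))"
    if "pcas u p v" "i < length p" for u v p i
    using that
    by (induct u p v arbitrary: i rule: pcas.induct) (auto simp: nth_Cons split: nat.splits)
  have last: "v = snd (last p)" if "pcas u p v" "p \<noteq> []" for u v and p :: "('a \<times> 'a) list"
    using that by (induct u p v rule: pcas.induct) (auto split: if_splits)
  \<comment> \<open>Each arc starts at the head of its cyclic predecessor; closedness handles index
    0.\<close>
  have wrap: "fst (p ! i) = snd (p ! (if i = 0 then length p - 1 else i - 1))"
    if "i < length p" for i
  proof -
    have "p \<noteq> []" using len by auto
    then show ?thesis
      using start[OF cas that] last[OF cas] by (simp add: last_conv_nth)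
  qed
  show ?thesis
  proof
    show "finite (snd ` set p)" "snd ` set p \<noteq> {}"
      using len by auto
    fix v assume "v \<in> snd ` set p"
    then obtain i where i: "i < length p" "v = snd (p ! i)"
      by (auto simp: in_set_conv_nth)
    \<comment> \<open>\<open>h\<close> and \<open>j\<close> are the cyclic predecessor and successor
      of \<open>i\<close>; they differ because the length is at least 3. The heads of these arcs are
      the neighbours of \<open>v\<close> on the cycle.\<close>
    define h where "h = (if i = 0 then length p - 1 else i - 1)"
    define j where "j = (if i = length p - 1 then 0 else i + 1)"
    have hj: "h < length p" "j < length p" "h \<noteq> j"
      using i len by (auto simp: h_def j_def)
    have "fst (p ! i) = snd (p ! h)"
      using wrap[OF i(1)] by (simp add: h_def)
    moreover have "fst (p ! j) = v"
      using wrap[OF hj(2)] i len by (auto simp: j_def split: if_splits)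
    ultimately have "p ! i = (snd (p ! h), v)" "p ! j = (v, snd (p ! j))"
      using i by (auto simp: prod_eq_iff)
    then have "(snd (p ! h), v) \<in> parcs G" "(v, snd (p ! j)) \<in> parcs G"
      using arcs nth_mem[OF i(1)] nth_mem[OF hj(2)] by auto
    moreover have "snd (p ! h) \<noteq> snd (p ! j)"
      using dist hj by (simp add: distinct_conv_nth)
    ultimately show "\<exists>u\<in>snd ` set p. \<exists>w\<in>snd ` set p.
        u \<noteq> w \<and> (v, u) \<in> parcs G \<and> (v, w) \<in> parcs G"
      using hj arcs_symmetric by (meson imageI nth_mem)
  qed
qed

end

section \<open>Distance and eccentricity\<close>

text \<open>A potential that falls by at most one along an arc bounds every walk to \<open>v\<close>
  from below, and descending by exactly one until it vanishes produces a walk attaining the bound.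
  This serves to recognise the distance in a product.\<close>

lemma (in pair_wf_digraph) gdist_eqI:
  fixes f :: "'a \<Rightarrow> nat"
  assumes zero: "\<And>u. u \<in> pverts G \<Longrightarrow> f u = 0 \<longleftrightarrow> u = v"
    and step: "\<And>u w. (u, w) \<in> parcs G \<Longrightarrow> f u \<le> Suc (f w)"
    and descent: "\<And>u. u \<in> pverts G \<Longrightarrow> 0 < f u \<Longrightarrow> \<exists>w. (u, w) \<in> parcs G \<and> f u = Suc (f w)"
    and u: "u \<in> pverts G"
  shows "gdist G u v = f u"
  unfolding gdist_def
proof (rule Least_equality)
  show "\<exists>p. awalk u p v \<and> length p = f u"
    using u
  proof (induct "f u" arbitrary: u)
    case 0
    then have "awalk u [] v"
      using zero[of u] by (simp add: awalk_Nil_iff)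
    with 0 show ?case by force
  next
    case (Suc n)
    then obtain w where w: "(u, w) \<in> parcs G" "f u = Suc (f w)"
      using descent[of u] by force
    with Suc obtain p where "awalk w p v" "length p = f w"
      using in_arcsD2[OF w(1)] by force
    with w have "awalk u ((u, w) # p) v \<and> length ((u, w) # p) = f u"
      by (simp add: awalk_Cons_iff)
    then show ?case by blast
  qed
next
  have "f u \<le> length p" if "awalk u p v" for p u
    using that
  proof (induct p arbitrary: u)
    case Nil
    then have "f u = 0"
      using zero[of u] by (metis awalk_Nil_iff)
    then show ?case by simp
  next
    case (Cons e p)
    then have "(u, snd e) \<in> parcs G" "f (snd e) \<le> length p"
      by (auto simp: awalk_Cons_iff)
    then show ?case using step[of u "snd e"] by simp
  qed
  then show "f u \<le> n" if "\<exists>p. awalk u p v \<and> length p = n" for n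
    using that by blast
qed

locale nontrivial_connected_graph = pair_graph +
  assumes conn: "Digraph_Component.connected (with_proj G)"
    and card_verts: "2 \<le> card (pverts G)"
begin

lemma shortest_walk:
  assumes "u \<in> pverts G" "v \<in> pverts G"
  obtains p where "awalk u p v" "length p = gdist G u v"
proof -
  have "strongly_connected (with_proj G)"
    using symmetric_connected_imp_strongly_connected[OF pair_sym_arcs conn] .
  with assms have "\<exists>n p. awalk u p v \<and> length p = n"
    by (auto simp: strongly_connected_def reachable_awalk)
  from LeastI_ex[OF this] show ?thesis
    using that unfolding gdist_def by blast
qed

lemma gdist_le: "awalk u p v \<Longrightarrow> gdist G u v \<le> length p"
  unfolding gdist_def by (rule Least_le) blast

lemma gdist_eq_0_iff:
  assumes "u \<in> pverts G" "v \<in> pverts G"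
  shows "gdist G u v = 0 \<longleftrightarrow> u = v"
proof
  assume "gdist G u v = 0"
  then show "u = v"
    using shortest_walk[OF assms] by (metis awalk_Nil_iff length_0_conv)
next
  assume "u = v"
  then show "gdist G u v = 0"
    using gdist_le[of u "[]" v] assms by (simp add: awalk_Nil_iff)
qed

lemma gdist_step:
  assumes "(u, w) \<in> parcs G" "v \<in> pverts G"
  shows "gdist G u v \<le> Suc (gdist G w v)"
proof -
  obtain p where "awalk w p v" "length p = gdist G w v"
    using shortest_walk in_arcsD2 assms by metis
  then show ?thesis
    using gdist_le[of u "(u, w) # p" v] assms by (simp add: awalk_Cons_iff)
qed

text \<open>Take the first arc of a shortest walk. With \<open>gdist_eq_0_iff\<close> and
  \<open>gdist_step\<close> this supplies, in one factor, what \<open>gdist_eqI\<close> asks of the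
  sum over all factors.\<close>

lemma gdist_descent:
  assumes "u \<in> pverts G" "v \<in> pverts G" "0 < gdist G u v"
  obtains w where "(u, w) \<in> parcs G" "gdist G u v = Suc (gdist G w v)"
proof -
  obtain p where p: "awalk u p v" "length p = gdist G u v"
    using shortest_walk assms by metis
  then obtain e q where q: "p = e # q"
    using assms by (cases p) auto
  with p have "(u, snd e) \<in> parcs G" "awalk (snd e) q v"
    by (auto simp: awalk_Cons_iff)
  then show ?thesis
    using that[of "snd e"] gdist_le[of "snd e" q v] gdist_step[of u "snd e" v] p q assms by simp
qed

lemma gdist_commute:
  assumes "u \<in> pverts G" "v \<in> pverts G"
  shows "gdist G u v = gdist G v u"
proof -
  have len: "length (rev_path p) = length p" for p :: "('a \<times> 'a) list"
    by (induct p) auto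
  have "gdist G v u \<le> gdist G u v" if "u \<in> pverts G" "v \<in> pverts G" for u v
    using shortest_walk[OF that] by (metis awalk_rev_path gdist_le len)
  then show ?thesis
    using assms by (simp add: le_antisym)
qed

text \<open>A second vertex lies at positive distance from \<open>v\<close>, so
  \<open>ecc G v\<close> is positive.\<close>

lemma eccentric_to_irrefl: "\<not> eccentric_to G v v"
proof
  assume v: "eccentric_to G v v"
  then have "v \<in> pverts G" by (simp add: eccentric_to_def)
  obtain u where u: "u \<in> pverts G" "u \<noteq> v"
    using card_verts \<open>v \<in> pverts G\<close>
    by (metis card_le_Suc0_iff_eq not_less_eq_eq numeral_2_eq_2 pair_finite_verts)
  have "gdist G u v \<le> ecc G v"
    unfolding ecc_def using u pair_finite_verts by (auto intro!: Max_ge)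
  with v u \<open>v \<in> pverts G\<close> show False
    using gdist_eq_0_iff by (metis eccentric_to_def le_zero_eq)
qed

end

text \<open>Trading the maximum for pairwise comparisons suits products, where a vertex is compared
  with its modification in one coordinate.\<close>

lemma eccentric_to_iff:
  assumes "finite (pverts G)"
  shows "eccentric_to G u v \<longleftrightarrow>
    u \<in> pverts G \<and> v \<in> pverts G \<and> (\<forall>w\<in>pverts G. gdist G w v \<le> gdist G u v)"
proof -
  let ?D = "{gdist G u v | u. u \<in> pverts G}"
  have "gdist G u v = ecc G v \<longleftrightarrow> (\<forall>w\<in>pverts G. gdist G w v \<le> gdist G u v)"
    if "u \<in> pverts G"
  proof -
    have "finite ?D" "gdist G u v \<in> ?D" using assms that by auto
    then show ?thesis
      unfolding ecc_def using Max_ge[of ?D] Max_eqI[of ?D "gdist G u v"]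
      by (smt (verit, best) mem_Collect_eq)
  qed
  then show ?thesis
    by (auto simp: eccentric_to_def)
qed

section \<open>Eccentric graphs\<close>

context nontrivial_connected_graph
begin

text \<open>Fills the remaining coordinates when a 4-cycle is built from two chosen factors.\<close>

lemma eccentric_vertex_exists:
  obtains u v where "eccentric_to G u v"
proof -
  obtain v where v: "v \<in> pverts G"
    using card_verts by (metis card.empty ex_in_conv not_numeral_le_zero)
  obtain u where "u \<in> pverts G" "\<forall>w\<in>pverts G. gdist G w v \<le> gdist G u v"
    using obtains_MAX[OF pair_finite_verts, of "\<lambda>w. gdist G w v"] v pair_finite_verts
    by (metis Max_ge empty_iff finite_imageI imageI)
  with v show ?thesis
    using that eccentric_to_iff[OF pair_finite_verts] by blast
qed

lemma arcs_eccentric_graph: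
  "(u, v) \<in> parcs (eccentric_graph G) \<longleftrightarrow> eccentric_to G u v \<or> eccentric_to G v u"
  using eccentric_to_irrefl by (auto simp: eccentric_graph_def eccentric_to_def)

text \<open>If \<open>v\<close> is eccentric to \<open>u\<close>, then \<open>ecc G u\<close> is
  their distance, which is at most \<open>ecc G v\<close>; the assumption forces equality, so
  \<open>u\<close> is eccentric to \<open>v\<close> as well.\<close>

lemma eccentric_to_larger_ecc:
  assumes "(u, v) \<in> parcs (eccentric_graph G)" "ecc G v \<le> ecc G u"
  shows "eccentric_to G u v"
proof (rule ccontr)
  assume not: "\<not> eccentric_to G u v"
  with assms have vu: "eccentric_to G v u"
    by (simp add: arcs_eccentric_graph)
  then have mem: "u \<in> pverts G" "v \<in> pverts G" and "gdist G v u = ecc G u"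
    by (auto simp: eccentric_to_def)
  moreover have "gdist G u v \<le> ecc G v"
    unfolding ecc_def using mem pair_finite_verts by (auto intro!: Max_ge)
  ultimately show False
    using not assms(2) gdist_commute[OF mem] by (simp add: eccentric_to_def)
qed

lemma two_eccentric_vertices:
  assumes "2 < girth (eccentric_graph G)"
  obtains a b c where "b \<noteq> c" "eccentric_to G b a" "eccentric_to G c a"
proof -
  interpret E: pair_graph "eccentric_graph G"
    by (rule pair_graph_eccentric_graph[OF pair_finite_verts])
  obtain S where S: "finite S" "S \<noteq> {}" "\<And>v. v \<in> S \<Longrightarrow> \<exists>u\<in>S. \<exists>w\<in>S. u \<noteq> w \<and>
      (v, u) \<in> parcs (eccentric_graph G) \<and> (v, w) \<in> parcs (eccentric_graph G)"
    using E.two_neighbours_on_cycle[OF assms] by blast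
  \<comment> \<open>Minimality makes both neighbours of \<open>a\<close> in \<open>S\<close>
    eccentric to it; the next lemma uses a maximum to reverse the direction.\<close>
  obtain a where a: "a \<in> S" "\<And>x. x \<in> S \<Longrightarrow> ecc G a \<le> ecc G x"
    using obtains_MIN[OF S(1,2), of "ecc G"] S(1) by (metis Min_le finite_imageI imageI)
  then show ?thesis
    using S(3)[OF a(1)] that eccentric_to_larger_ecc E.arcs_symmetric by metis
qed

lemma eccentric_to_two_vertices:
  assumes "2 < girth (eccentric_graph G)"
  obtains a b c where "b \<noteq> c" "eccentric_to G a b" "eccentric_to G a c"
proof -
  interpret E: pair_graph "eccentric_graph G"
    by (rule pair_graph_eccentric_graph[OF pair_finite_verts])
  obtain S where S: "finite S" "S \<noteq> {}" "\<And>v. v \<in> S \<Longrightarrow> \<exists>u\<in>S. \<exists>w\<in>S. u \<noteq> w \<and>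
      (v, u) \<in> parcs (eccentric_graph G) \<and> (v, w) \<in> parcs (eccentric_graph G)"
    using E.two_neighbours_on_cycle[OF assms] by blast
  obtain a where a: "a \<in> S" "\<And>x. x \<in> S \<Longrightarrow> ecc G x \<le> ecc G a"
    using obtains_MAX[OF S(1,2), of "ecc G"] S(1) by (metis Max_ge finite_imageI imageI)
  then show ?thesis
    using S(3)[OF a(1)] that eccentric_to_larger_ecc by metis
qed

text \<open>Sorting the corners of a triangle by eccentricity orients its edges transitively. This
  fixed pattern allows triangles of different factors to be combined, as an edge of the product
  needs the same direction in every coordinate.\<close>

lemma girth_eccentric_graph_eq_3_iff:
  "girth (eccentric_graph G) = 3 \<longleftrightarrow>
    (\<exists>a b c. eccentric_to G a b \<and> eccentric_to G b c \<and> eccentric_to G a c)"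
proof -
  interpret E: pair_graph "eccentric_graph G"
    by (rule pair_graph_eccentric_graph[OF pair_finite_verts])
  have "\<exists>a b c. eccentric_to G a b \<and> eccentric_to G b c \<and> eccentric_to G a c"
    if arcs: "(a, b) \<in> parcs (eccentric_graph G)" "(b, c) \<in> parcs (eccentric_graph G)"
      "(c, a) \<in> parcs (eccentric_graph G)" for a b c
  proof -
    note rev = arcs[THEN E.arcs_symmetric]
    note ecc = eccentric_to_larger_ecc
    consider "ecc G a \<le> ecc G b \<and> ecc G b \<le> ecc G c" | "ecc G a \<le> ecc G c \<and> ecc G c \<le> ecc G b"
      | "ecc G b \<le> ecc G a \<and> ecc G a \<le> ecc G c" | "ecc G b \<le> ecc G c \<and> ecc G c \<le> ecc G a"
      | "ecc G c \<le> ecc G a \<and> ecc G a \<le> ecc G b" | "ecc G c \<le> ecc G b \<and> ecc G b \<le> ecc G a"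
      by linarith
    then show ?thesis
      by cases (metis arcs rev ecc order.trans)+
  qed
  then show ?thesis
    unfolding E.girth_eq_3_iff arcs_eccentric_graph by metis
qed

end

section \<open>Cartesian products\<close>

text \<open>For empty \<open>I\<close> the coordinatewise criterion for eccentricity would hold
  vacuously, even between a vertex and itself.\<close>

locale graph_family =
  fixes I :: "'i set" and G :: "'i \<Rightarrow> 'a pair_pre_digraph"
  assumes finite_index: "finite I" and index_nonempty: "I \<noteq> {}"
    and factor: "\<And>i. i \<in> I \<Longrightarrow> nontrivial_connected_graph (G i)"
begin

abbreviation P where "P \<equiv> cartesian_product I G"

lemma pverts_P: "pverts P = (\<Pi>\<^sub>E i\<in>I. pverts (G i))"
  by (simp add: cartesian_product_def)

lemma pair_graph_P: "pair_graph P"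
  using pair_graph_cartesian_product[OF finite_index] factor
  by (metis nontrivial_connected_graph.axioms(1))

text \<open>The sum meets the conditions of \<open>gdist_eqI\<close>: an arc of the product changes
  a single summand, and a positive summand can be lowered by moving in its own coordinate.\<close>

lemma gdist_P:
  assumes x: "x \<in> pverts P" and z: "z \<in> pverts P"
  shows "gdist P x z = (\<Sum>i\<in>I. gdist (G i) (x i) (z i))"
proof -
  interpret P: pair_graph P by (rule pair_graph_P)
  let ?f = "\<lambda>x. \<Sum>i\<in>I. gdist (G i) (x i) (z i)"
  have zi: "z i \<in> pverts (G i)" if "i \<in> I" for i
    using z that by (auto simp: pverts_P)
  show ?thesis
  proof (rule P.gdist_eqI[OF _ _ _ x])
    fix y assume y: "y \<in> pverts P"
    then have yi: "y i \<in> pverts (G i)" if "i \<in> I" for i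
      using that by (auto simp: pverts_P)
    have "?f y = 0 \<longleftrightarrow> (\<forall>i\<in>I. y i = z i)"
      using finite_index nontrivial_connected_graph.gdist_eq_0_iff[OF factor yi zi] by simp
    \<comment> \<open>Tuples are extensional, so agreement on \<open>I\<close> is equality.\<close>
    also have "\<dots> \<longleftrightarrow> y = z"
      using y z by (auto simp: pverts_P intro: PiE_ext)
    finally show "?f y = 0 \<longleftrightarrow> y = z" .
    assume "0 < ?f y"
    then obtain i where i: "i \<in> I" "0 < gdist (G i) (y i) (z i)"
      using sum_nonpos[of I "\<lambda>i. gdist (G i) (y i) (z i)"] by (fastforce simp: not_less)
    interpret nontrivial_connected_graph "G i" by (rule factor[OF i(1)])
    obtain w where w: "(y i, w) \<in> parcs (G i)"
      "gdist (G i) (y i) (z i) = Suc (gdist (G i) w (z i))"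
      using gdist_descent[OF yi[OF i(1)] zi[OF i(1)] i(2)] .
    have "y(i := w) \<in> pverts P"
      using y i(1) in_arcsD2[OF w(1)] by (auto simp: pverts_P PiE_iff extensional_def)
    moreover have "{j \<in> I. y j \<noteq> (y(i := w)) j} = {i}"
      using i(1) no_loops'[OF w(1)] by auto
    ultimately have "(y, y(i := w)) \<in> parcs P"
      using y i(1) w(1) unfolding pverts_P by (auto simp: cartesian_product_def)
    moreover have "?f y = Suc (?f (y(i := w)))"
      using i(1) w(2) finite_index by (simp add: sum.remove[of I i])
    ultimately show "\<exists>w. (y, w) \<in> parcs P \<and> ?f y = Suc (?f w)"
      by blast
  next
    fix y w assume "(y, w) \<in> parcs P"
    then obtain i where i: "i \<in> I" "{j \<in> I. y j \<noteq> w j} = {i}" "(y i, w i) \<in> parcs (G i)"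
      by (auto simp: cartesian_product_def)
    have "y j = w j" if "j \<in> I - {i}" for j
      using i(2) that by blast
    then have "(\<Sum>j\<in>I - {i}. gdist (G j) (y j) (z j)) = (\<Sum>j\<in>I - {i}. gdist (G j) (w j) (z j))"
      by simp
    moreover have "gdist (G i) (y i) (z i) \<le> Suc (gdist (G i) (w i) (z i))"
      using nontrivial_connected_graph.gdist_step[OF factor[OF i(1)] i(3) zi[OF i(1)]] .
    ultimately show "?f y \<le> Suc (?f w)"
      using i(1) finite_index by (simp add: sum.remove[of I i])
  qed
qed

text \<open>Coordinates vary independently, so a sum of distances is maximal exactly when every
  summand is.\<close>

lemma eccentric_to_P:
  assumes x: "x \<in> pverts P" and y: "y \<in> pverts P"
  shows "eccentric_to P x y \<longleftrightarrow> (\<forall>i\<in>I. eccentric_to (G i) (x i) (y i))"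
proof -
  interpret P: pair_graph P by (rule pair_graph_P)
  have fin: "finite (pverts (G i))" if "i \<in> I" for i
  proof -
    interpret nontrivial_connected_graph "G i" by (rule factor[OF that])
    show ?thesis by (rule pair_finite_verts)
  qed
  have mem: "x i \<in> pverts (G i)" "y i \<in> pverts (G i)" if "i \<in> I" for i
    using x y that by (auto simp: pverts_P)
  show ?thesis
  proof
    assume ecc: "eccentric_to P x y"
    show "\<forall>i\<in>I. eccentric_to (G i) (x i) (y i)"
    proof
      fix i assume i: "i \<in> I"
      have "gdist (G i) w (y i) \<le> gdist (G i) (x i) (y i)" if w: "w \<in> pverts (G i)" for w
      proof -
        \<comment> \<open>Changing only coordinate \<open>i\<close> leaves all other summands equal,
          and they cancel in the comparison.\<close>
        have x': "x(i := w) \<in> pverts P"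
          using x i w by (auto simp: pverts_P PiE_iff extensional_def)
        then have "gdist P (x(i := w)) y \<le> gdist P x y"
          using ecc by (simp add: eccentric_to_iff[OF P.pair_finite_verts])
        then show ?thesis
          using i finite_index by (simp add: gdist_P x x' y sum.remove[of I i])
      qed
      then show "eccentric_to (G i) (x i) (y i)"
        using i mem by (simp add: eccentric_to_iff[OF fin])
    qed
  next
    assume "\<forall>i\<in>I. eccentric_to (G i) (x i) (y i)"
    then have "gdist (G i) w (y i) \<le> gdist (G i) (x i) (y i)"
      if "i \<in> I" "w \<in> pverts (G i)" for i w
      using that fin by (simp add: eccentric_to_iff)
    then have "gdist P w y \<le> gdist P x y" if "w \<in> pverts P" for w
      using that x y by (simp add: gdist_P) (rule sum_mono, auto simp: pverts_P)
    then show "eccentric_to P x y"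
      using x y by (simp add: eccentric_to_iff[OF P.pair_finite_verts])
  qed
qed

lemma arcs_eccentric_graph_P:
  assumes x: "x \<in> pverts P" and y: "y \<in> pverts P"
  shows "(x, y) \<in> parcs (eccentric_graph P) \<longleftrightarrow>
    (\<forall>i\<in>I. eccentric_to (G i) (x i) (y i)) \<or> (\<forall>i\<in>I. eccentric_to (G i) (y i) (x i))"
proof -
  have "\<not> (\<forall>i\<in>I. eccentric_to (G i) (x i) (x i))"
    using index_nonempty nontrivial_connected_graph.eccentric_to_irrefl[OF factor] by blast
  then show ?thesis
    using assms by (auto simp: eccentric_graph_def eccentric_to_P)
qed

lemma eccentric_to_PI:
  assumes "\<And>i. i \<in> I \<Longrightarrow> eccentric_to (G i) (x i) (y i)"
  shows "(restrict x I, restrict y I) \<in> parcs (eccentric_graph P)"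
    "(restrict y I, restrict x I) \<in> parcs (eccentric_graph P)"
proof -
  have "restrict x I \<in> pverts P" "restrict y I \<in> pverts P"
    using assms by (auto simp: pverts_P eccentric_to_def)
  then show "(restrict x I, restrict y I) \<in> parcs (eccentric_graph P)"
    "(restrict y I, restrict x I) \<in> parcs (eccentric_graph P)"
    using assms by (auto simp: arcs_eccentric_graph_P)
qed

lemma girth_P_eq_3_iff:
  "girth (eccentric_graph P) = 3 \<longleftrightarrow> (\<forall>i\<in>I. girth (eccentric_graph (G i)) = 3)"
proof -
  interpret P: pair_graph P by (rule pair_graph_P)
  interpret E: pair_graph "eccentric_graph P"
    by (rule pair_graph_eccentric_graph[OF P.pair_finite_verts])
  show ?thesis
  proof
    assume "girth (eccentric_graph P) = 3"
    then obtain x y z where arcs: "(x, y) \<in> parcs (eccentric_graph P)"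
      "(y, z) \<in> parcs (eccentric_graph P)" "(z, x) \<in> parcs (eccentric_graph P)"
      unfolding E.girth_eq_3_iff by blast
    show "\<forall>i\<in>I. girth (eccentric_graph (G i)) = 3"
    proof
      fix i assume i: "i \<in> I"
      interpret nontrivial_connected_graph "G i" by (rule factor[OF i])
      interpret Ei: pair_graph "eccentric_graph (G i)"
        by (rule pair_graph_eccentric_graph[OF pair_finite_verts])
      \<comment> \<open>Projection to a coordinate maps edges to edges, hence triangles to
        triangles.\<close>
      have "(u i, v i) \<in> parcs (eccentric_graph (G i))"
        if "(u, v) \<in> parcs (eccentric_graph P)" for u v
      proof -
        have "u \<in> pverts P" "v \<in> pverts P"
          using that by (auto simp: eccentric_graph_def)
        then show ?thesis
          using that i by (auto simp: arcs_eccentric_graph_P arcs_eccentric_graph)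
      qed
      with arcs show "girth (eccentric_graph (G i)) = 3"
        unfolding Ei.girth_eq_3_iff by blast
    qed
  next
    assume "\<forall>i\<in>I. girth (eccentric_graph (G i)) = 3"
    then have "\<forall>i\<in>I. \<exists>a b c. eccentric_to (G i) a b \<and> eccentric_to (G i) b c \<and> eccentric_to (G i) a c"
      using nontrivial_connected_graph.girth_eccentric_graph_eq_3_iff[OF factor] by blast
    then obtain a b c where "\<And>i. i \<in> I \<Longrightarrow>
        eccentric_to (G i) (a i) (b i) \<and> eccentric_to (G i) (b i) (c i) \<and> eccentric_to (G i) (a i) (c i)"
      by metis
    then show "girth (eccentric_graph P) = 3"
      unfolding E.girth_eq_3_iff
      \<comment> \<open>The closing arc from \<open>c\<close> to \<open>a\<close> is the reversal of
        \<open>a\<close> being eccentric to \<open>c\<close>.\<close>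
      using eccentric_to_PI(1)[of a b] eccentric_to_PI(1)[of b c] eccentric_to_PI(2)[of a c] by blast
  qed
qed

lemma girth_P_le_4:
  assumes st: "s \<in> I" "t \<in> I" "s \<noteq> t"
    and s: "2 < girth (eccentric_graph (G s))" and t: "2 < girth (eccentric_graph (G t))"
  shows "girth (eccentric_graph P) = 3 \<or> girth (eccentric_graph P) = 4"
proof -
  interpret P: pair_graph P by (rule pair_graph_P)
  interpret E: pair_graph "eccentric_graph P"
    by (rule pair_graph_eccentric_graph[OF P.pair_finite_verts])
  obtain a b c where abc: "b \<noteq> c" "eccentric_to (G s) b a" "eccentric_to (G s) c a"
    using nontrivial_connected_graph.two_eccentric_vertices[OF factor[OF st(1)] s] .
  obtain a' b' c' where abc': "b' \<noteq> c'" "eccentric_to (G t) a' b'" "eccentric_to (G t) a' c'"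
    using nontrivial_connected_graph.eccentric_to_two_vertices[OF factor[OF st(2)] t] .
  have "\<forall>i\<in>I. \<exists>p q. eccentric_to (G i) p q"
    using nontrivial_connected_graph.eccentric_vertex_exists[OF factor] by metis
  then obtain p q where pq: "\<And>i. i \<in> I \<Longrightarrow> eccentric_to (G i) (p i) (q i)"
    by metis
  \<comment> \<open>One side of the 4-cycle varies only at \<open>s\<close>, with \<open>x\<close>
    being \<open>b\<close> or \<open>c\<close>; the other only at \<open>t\<close>, with
    \<open>y\<close> being \<open>b'\<close> or \<open>c'\<close>. Every tuple of the first side is
    eccentric to every tuple of the second.\<close>
  have arcs: "(restrict (p(s := x, t := a')) I, restrict (q(s := a, t := y)) I) \<in> parcs (eccentric_graph P)"
    "(restrict (q(s := a, t := y)) I, restrict (p(s := x, t := a')) I) \<in> parcs (eccentric_graph P)"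
    if "eccentric_to (G s) x a" "eccentric_to (G t) a' y" for x y
    using that pq st by (intro eccentric_to_PI; simp)+
  \<comment> \<open>Opposite corners differ at \<open>s\<close> on one side and at \<open>t\<close>
    on the other.\<close>
  have "restrict (p(s := b, t := a')) I s \<noteq> restrict (p(s := c, t := a')) I s"
    "restrict (q(s := a, t := b')) I t \<noteq> restrict (q(s := a, t := c')) I t"
    using st abc(1) abc'(1) by auto
  then show ?thesis
    using E.girth_le_4[OF arcs(1)[of b b'] arcs(2)[of c b'] arcs(1)[of c c'] arcs(2)[of b c']] abc abc'
    by metis
qed

end

theorem theorem5:
  fixes k :: nat and G :: "nat \<Rightarrow> 'a pair_pre_digraph"
  assumes "\<And>i. i \<in> {1..k} \<Longrightarrow> pair_graph (G i)"
    and "\<And>i. i \<in> {1..k} \<Longrightarrow> Digraph_Component.connected (with_proj (G i))"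
    and "\<And>i. i \<in> {1..k} \<Longrightarrow> card (pverts (G i)) \<ge> 2"
    and "card {i \<in> {1..k}. girth (eccentric_graph (G i)) > 2} \<ge> 2"
  shows "girth (eccentric_graph (cartesian_product {1..k} G)) = 4 \<longleftrightarrow>
    \<not> (\<forall>i\<in>{1..k}. girth (eccentric_graph (G i)) = 3)"
proof -
  obtain s t where st: "s \<in> {1..k}" "t \<in> {1..k}" "s \<noteq> t"
    "2 < girth (eccentric_graph (G s))" "2 < girth (eccentric_graph (G t))"
    using assms(4) card_le_Suc0_iff_eq[of "{i \<in> {1..k}. girth (eccentric_graph (G i)) > 2}"]
    by (auto simp: not_le[symmetric])
  have "nontrivial_connected_graph (G i)" if "i \<in> {1..k}" for i
    using assms(1-3)[OF that]
    by (simp add: nontrivial_connected_graph_def nontrivial_connected_graph_axioms_def)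
  then interpret graph_family "{1..k}" G
    using st(1) by (auto simp: graph_family_def)
  show ?thesis
    \<comment> \<open>The girth is 3 or 4, so it is 4 exactly when the criterion for 3
      fails.\<close>
    using girth_P_le_4[OF st] girth_P_eq_3_iff by auto
qed

end
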